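(* Let $(T(t))_{t\ge 0}$ be a quasi-multiplication semigroup on a Banach space $X$ with generator $-A$. Assume that $\sigma(A)\subset\mathbb{C}_+$ and $\inf\{\operatorname{Re}\lambda:\lambda\in\sigma(A)\}=0$. Let $$M(s)=\sup\left\{\|(ir+A)^{-1}\| : |r|\le s\right\},\qquad s\ge 0,$$ and let $c>0$. The following are equivalent: (i) There exists $C$ such that $$\|T(t)A^{-1}\|\le\frac{C}{M^{-1}(ct)},\qquad t\ge c^{-1}M(0);$$ (ii) There exists $B$ such that $$\frac{M(\tau)}{M(s)}\ge c\log\left(\frac{\tau}{s}\right)-B,\qquad \tau>0,\ s\ge 1.$$
   Context: $\mathbb{C}_+=\{\lambda\in\mathbb{C}:\operatorname{Re}\lambda>0\}$. A quasi-multiplication semigroup is a bounded $C_0$-semigroup $(T(t))_{t\ge0}$ with generator $-A$ such that $$\|T(t)r(A)\|=\sup\big\{|e^{-\lambda t}r(\lambda)| : \lambda\in\sigma(A)\big\}$$ for every $t\ge 0$ and every rational function $r$ whose poles are outside $\sigma(A)$ and which is bounded at infinity. The function $M$ is continuous and increasing (not necessarily strictly) and, under the assumptions, tends to infinity; $M^{-1}$ denotes a right inverse of $M$, i.e. $M(M^{-1}(t))=t$ for all $t\ge M(0)$. If $M^{-1}(ct)=0$, the bound in (i) is regarded as vacuous. *)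

theory Defs
  imports "HOL-Analysis.Analysis" "HOL-Computational_Algebra.Polynomial"
begin

class complex_banach = banach +
  fixes scaleC :: "complex \<Rightarrow> 'a \<Rightarrow> 'a" (infixr \<open>*\<^sub>C\<close> 75)
  assumes scaleC_add_right: "a *\<^sub>C (x + y) = a *\<^sub>C x + a *\<^sub>C y"
    and scaleC_add_left: "(a + b) *\<^sub>C x = a *\<^sub>C x + b *\<^sub>C x"
    and scaleC_scaleC: "a *\<^sub>C (b *\<^sub>C x) = (a * b) *\<^sub>C x"
    and scaleC_of_real: "complex_of_real r *\<^sub>C x = r *\<^sub>R x"
    and norm_scaleC: "norm (a *\<^sub>C x) = cmod a * norm x"

instantiation complex :: complex_banach
begin

definition scaleC_complex :: "complex \<Rightarrow> complex \<Rightarrow> complex"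
  where "scaleC_complex = (*)"

instance
  by standard (auto simp: scaleC_complex_def algebra_simps norm_mult scaleR_conv_of_real)

end

text \<open>An operator is given by its domain \<open>D\<close> and a function \<open>A\<close>; the values of \<open>A\<close> outside \<open>D\<close>
  are irrelevant.\<close>

definition resolvent_set :: "'a::complex_banach set \<Rightarrow> ('a \<Rightarrow> 'a) \<Rightarrow> complex set"
  where "resolvent_set D A =
    {z. bij_betw (\<lambda>x. z *\<^sub>C x - A x) D UNIV \<and>
        bounded_linear (inv_into D (\<lambda>x. z *\<^sub>C x - A x))}"

definition spectrum :: "'a::complex_banach set \<Rightarrow> ('a \<Rightarrow> 'a) \<Rightarrow> complex set"
  where "spectrum D A = - resolvent_set D A"

text \<open>\<open>pow_domain D A n\<close> is the domain of the \<open>n\<close>-th power of the operator, and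
  \<open>pow_domain D A (degree p)\<close> that of \<open>poly_op A p\<close>.\<close>

definition pow_domain :: "'a set \<Rightarrow> ('a \<Rightarrow> 'a) \<Rightarrow> nat \<Rightarrow> 'a set"
  where "pow_domain D A n = {x. \<forall>k<n. (A ^^ k) x \<in> D}"

definition poly_op :: "('a::complex_banach \<Rightarrow> 'a) \<Rightarrow> complex poly \<Rightarrow> 'a \<Rightarrow> 'a"
  where "poly_op A p x = (\<Sum>k\<le>degree p. coeff p k *\<^sub>C (A ^^ k) x)"

text \<open>For \<open>r = p / q\<close> bounded at infinity and without poles in the spectrum, \<open>r(A)\<close> is
  \<open>p(A)\<close> applied after the inverse of \<open>q(A)\<close>. That inverse maps into the domain of \<open>p(A)\<close> because
  \<open>degree p \<le> degree q\<close>.\<close>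

definition rational_op ::
    "'a::complex_banach set \<Rightarrow> ('a \<Rightarrow> 'a) \<Rightarrow> complex poly \<Rightarrow> complex poly \<Rightarrow> 'a \<Rightarrow> 'a"
  where "rational_op D A p q =
    poly_op A p \<circ> inv_into (pow_domain D A (degree q)) (poly_op A q)"

definition resolvent_growth :: "'a::complex_banach set \<Rightarrow> ('a \<Rightarrow> 'a) \<Rightarrow> real \<Rightarrow> real"
  where "resolvent_growth D A s =
    (SUP r\<in>{r. \<bar>r\<bar> \<le> s}. onorm (inv_into D (\<lambda>x. (\<i> * complex_of_real r) *\<^sub>C x + A x)))"

definition C0_semigroup :: "(real \<Rightarrow> 'a::complex_banach \<Rightarrow> 'a) \<Rightarrow> bool"
  where "C0_semigroup T \<longleftrightarrow>
    (\<forall>t\<ge>0. bounded_linear (T t) \<and> (\<forall>a x. T t (a *\<^sub>C x) = a *\<^sub>C T t x)) \<and>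
    T 0 = id \<and>
    (\<forall>s\<ge>0. \<forall>t\<ge>0. T (s + t) = T s \<circ> T t) \<and>
    (\<forall>x. continuous_on {0..} (\<lambda>t. T t x))"

definition bounded_semigroup :: "(real \<Rightarrow> 'a::complex_banach \<Rightarrow> 'a) \<Rightarrow> bool"
  where "bounded_semigroup T \<longleftrightarrow> (\<exists>K. \<forall>t\<ge>0. onorm (T t) \<le> K)"

definition is_generator ::
    "(real \<Rightarrow> 'a::complex_banach \<Rightarrow> 'a) \<Rightarrow> 'a set \<Rightarrow> ('a \<Rightarrow> 'a) \<Rightarrow> bool"
  where "is_generator T D G \<longleftrightarrow>
    D = {x. \<exists>y. ((\<lambda>h. (T h x - x) /\<^sub>R h) \<longlongrightarrow> y) (at_right 0)} \<and>
    (\<forall>x\<in>D. ((\<lambda>h. (T h x - x) /\<^sub>R h) \<longlongrightarrow> G x) (at_right 0))"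

text \<open>The generator is \<open>-A\<close>, with domain \<open>D\<close>. Rational functions are written as \<open>p / q\<close> with \<open>q\<close>
  free of zeros on the spectrum; this covers all those whose poles lie outside the spectrum. The
  supremum is taken in \<open>ennreal\<close>, so that no junk value arises for unbounded or empty sets.\<close>

definition quasi_multiplication_semigroup ::
    "(real \<Rightarrow> 'a::complex_banach \<Rightarrow> 'a) \<Rightarrow> 'a set \<Rightarrow> ('a \<Rightarrow> 'a) \<Rightarrow> bool"
  where "quasi_multiplication_semigroup T D A \<longleftrightarrow>
    C0_semigroup T \<and> bounded_semigroup T \<and> is_generator T D (\<lambda>x. - A x) \<and>
    (\<forall>t\<ge>0. \<forall>p q :: complex poly.
       q \<noteq> 0 \<longrightarrow> (\<forall>z\<in>spectrum D A. poly q z \<noteq> 0) \<longrightarrow>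
       Bfun (\<lambda>z. poly p z / poly q z) at_infinity \<longrightarrow>
       ennreal (onorm (T t \<circ> rational_op D A p q)) =
         (SUP z\<in>spectrum D A.
            ennreal (cmod (exp (- z * complex_of_real t) * (poly p z / poly q z)))))"

end

theory Submission
  imports Defs
begin

text \<open>
  For a quasi-multiplication semigroup every norm in the statement is a supremum over the spectrum
  \<open>S\<close>: \<open>\<parallel>T(t)A\<inverse>\<parallel>\<close> is the supremum of \<open>exp (- t Re z) / \<bar>z\<bar>\<close>, and
  \<open>M s\<close> is the supremum of \<open>1 / \<bar>ir + z\<bar>\<close> over \<open>z \<in> S\<close> and \<open>\<bar>r\<bar> \<le> s\<close>. The equivalence is therefore
  a statement about the position of \<open>S\<close> in the right half-plane. Both conditions are equivalent to
  the pointwise estimate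
  \[ M(\tau) \, \mathrm{Re}\, z \ge c \log (\tau / |z|) - B, \qquad \tau > 0,\ z \in S. \]

  With \<open>\<tau> = M\<inverse>(ct)\<close>, so that \<open>ct = M(\<tau>)\<close>, the inequality \<open>exp (- t Re z) / \<bar>z\<bar> \<le> C / \<tau>\<close>
  becomes this estimate, with \<open>B = c log C\<close>, after taking logarithms
  (\<open>decay_iff_pointwise\<close>). The right inverse may skip values of \<open>\<tau>\<close> on which \<open>M\<close> is locally
  constant; these are recovered by approximating \<open>M(\<tau>)\<close> from above.

  The ratio condition follows from the pointwise one because \<open>1 / M(s)\<close> is the distance from \<open>S\<close>
  to the segment from \<open>-is\<close> to \<open>is\<close>, and only points \<open>z \<in> S\<close> with \<open>\<bar>z\<bar>\<close> at most a multiple of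
  \<open>s\<close> matter for it. Conversely \<open>M(s) \<ge> 1 / Re z\<close> when \<open>s = max 1 \<bar>Im z\<bar>\<close>, and this \<open>s\<close> is at most
  a multiple of \<open>\<bar>z\<bar>\<close> as \<open>S\<close> stays away from \<open>0\<close> (\<open>ratio_iff_pointwise\<close>). Multiplicative constants
  turn into additive ones under the logarithm and are absorbed by \<open>B\<close>.
\<close>

section \<open>Operator norms as suprema over the spectrum\<close>

text \<open>Positivity of the \<open>f z\<close> rules out that a negative \<open>x\<close> is truncated to \<open>0\<close> by \<^const>\<open>ennreal\<close>.\<close>

lemma le_iff_if_ennreal_eq_SUP:
  fixes f :: "'b \<Rightarrow> real"
  assumes x: "ennreal x = (SUP z\<in>S. ennreal (f z))"
    and pos: "\<And>z. z \<in> S \<Longrightarrow> f z > 0" and "S \<noteq> {}"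
  shows "x \<le> W \<longleftrightarrow> (\<forall>z\<in>S. f z \<le> W)"
proof -
  have le: "f z \<le> x" if "z \<in> S" for z
  proof -
    have "ennreal (f z) \<le> ennreal x" unfolding x by (rule SUP_upper[OF that])
    then show ?thesis using pos[OF that] by (auto simp: ennreal_le_iff2)
  qed
  obtain z0 where "z0 \<in> S" using \<open>S \<noteq> {}\<close> by auto
  then have "x > 0" using le pos by fastforce
  show ?thesis
  proof
    assume W: "\<forall>z\<in>S. f z \<le> W"
    then have "W > 0" using pos[OF \<open>z0 \<in> S\<close>] \<open>z0 \<in> S\<close> by fastforce
    have "ennreal x \<le> ennreal W" unfolding x using W by (intro SUP_least) (auto intro: ennreal_leI)
    then show "x \<le> W" using \<open>W > 0\<close> by (auto simp: ennreal_le_iff2)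
  qed (use le in fastforce)
qed

lemma rational_op_resolvent:
  "rational_op D A 1 [:w, 1:] = inv_into D (\<lambda>x. w *\<^sub>C x + A x)"
proof -
  have one: "1 *\<^sub>C x = x" for x :: 'a using scaleC_of_real[of 1 x] by simp
  have "poly_op A 1 = id"
    by (auto simp: poly_op_def one)
  moreover have "poly_op A [:w, 1:] = (\<lambda>x. w *\<^sub>C x + A x)"
    by (auto simp: poly_op_def one)
  moreover have "pow_domain D A (degree [:w, 1:]) = D"
    by (auto simp: pow_domain_def)
  ultimately show ?thesis by (simp add: rational_op_def)
qed

lemma Bfun_inverse_linear_at_infinity:
  "Bfun (\<lambda>z::complex. 1 / (w + z)) at_infinity"
proof -
  have "((\<lambda>z::complex. 1 / (w + z)) \<longlongrightarrow> 0) at_infinity"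
    by (intro tendsto_divide_0[OF tendsto_const] tendsto_add_filterlim_at_infinity[OF tendsto_const]
        filterlim_ident)
  then have "eventually (\<lambda>z. cmod (1 / (w + z)) \<le> 1) at_infinity"
    by (auto dest!: tendstoD[where e = 1] elim!: eventually_mono)
  then show ?thesis by (rule BfunI)
qed

text \<open>This is the defining norm identity for the rational function \<open>1 / (w + z)\<close>: \<open>w = 0\<close> gives
  \<open>T(t)A\<inverse>\<close>, and \<open>w = ir\<close> with \<open>t = 0\<close> gives the resolvents on the imaginary axis. Characterising the upper bounds of the
  norm records its value as a supremum together with the finiteness of that supremum.\<close>

lemma semigroup_resolvent_norm_le_iff:
  assumes qm: "quasi_multiplication_semigroup T D A"
    and "spectrum D A \<noteq> {}" and w: "- w \<notin> spectrum D A" and "t \<ge> 0"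
  shows "onorm (T t \<circ> inv_into D (\<lambda>x. w *\<^sub>C x + A x)) \<le> W \<longleftrightarrow>
    (\<forall>z\<in>spectrum D A. exp (- Re z * t) / cmod (w + z) \<le> W)"
proof (rule le_iff_if_ennreal_eq_SUP)
  have nz: "w + z \<noteq> 0" if "z \<in> spectrum D A" for z
    using that w by (metis add.commute add_eq_0_iff)
  then have "\<forall>z\<in>spectrum D A. poly [:w, 1:] z \<noteq> 0" by auto
  moreover have "Bfun (\<lambda>z. poly 1 z / poly [:w, 1:] z) at_infinity"
    using Bfun_inverse_linear_at_infinity[of w] by simp
  ultimately have "ennreal (onorm (T t \<circ> rational_op D A 1 [:w, 1:])) =
      (SUP z\<in>spectrum D A.
        ennreal (cmod (exp (- z * complex_of_real t) * (poly 1 z / poly [:w, 1:] z))))"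
    using qm \<open>t \<ge> 0\<close> unfolding quasi_multiplication_semigroup_def by fastforce
  then show "ennreal (onorm (T t \<circ> inv_into D (\<lambda>x. w *\<^sub>C x + A x))) =
      (SUP z\<in>spectrum D A. ennreal (exp (- Re z * t) / cmod (w + z)))"
    by (simp add: rational_op_resolvent norm_mult norm_divide)
  show "exp (- Re z * t) / cmod (w + z) > 0" if "z \<in> spectrum D A" for z
    using nz[OF that] by simp
qed fact

text \<open>The supremum over \<open>\<bar>r\<bar> \<le> s\<close> has to be shown finite. The norm of \<open>(ir + A)\<inverse>\<close> is the
  reciprocal of the distance from \<open>-ir\<close> to the spectrum; this distance depends continuously on
  \<open>r\<close> and is positive, hence bounded below on the compact interval.\<close>

lemma resolvent_growth_le_iff:
  assumes qm: "quasi_multiplication_semigroup T D A"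
    and ne: "spectrum D A \<noteq> {}" and pos: "spectrum D A \<subseteq> {z. Re z > 0}" and "s \<ge> 0"
  shows "resolvent_growth D A s \<le> W \<longleftrightarrow>
    (\<forall>r z. \<bar>r\<bar> \<le> s \<longrightarrow> z \<in> spectrum D A \<longrightarrow> 1 / cmod (\<i> * of_real r + z) \<le> W)"
proof -
  let ?S = "spectrum D A"
  define R where "R = (\<lambda>r. onorm (inv_into D (\<lambda>x. (\<i> * complex_of_real r) *\<^sub>C x + A x)))"
  have R: "R r \<le> W \<longleftrightarrow> (\<forall>z\<in>?S. 1 / cmod (\<i> * of_real r + z) \<le> W)" for r W
  proof -
    have "- (\<i> * of_real r) \<notin> ?S" using pos by auto
    from semigroup_resolvent_norm_le_iff[OF qm ne this, of 0 W] show ?thesis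
      using qm by (simp add: R_def quasi_multiplication_semigroup_def C0_semigroup_def)
  qed
  have dist_eq: "cmod (\<i> * of_real r + z) = dist (- (\<i> * of_real r)) z" for r z
    by (simp add: dist_norm norm_minus_commute add.commute)
  have nz: "cmod (\<i> * of_real r + z) > 0" if "z \<in> ?S" for r z
    using pos that by (auto simp: complex_eq_iff)
  have infdist_pos: "infdist (- (\<i> * of_real r)) ?S > 0" for r
  proof -
    have "R r > 0"
    proof -
      obtain z where "z \<in> ?S" using ne by auto
      then have "1 / cmod (\<i> * of_real r + z) \<le> R r" using R[of r "R r"] by auto
      then show ?thesis using nz[OF \<open>z \<in> ?S\<close>, of r] by (smt (verit) zero_less_divide_1_iff)
    qed
    have "1 / R r \<le> dist (- (\<i> * of_real r)) z" if "z \<in> ?S" for z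
    proof -
      have "1 / cmod (\<i> * of_real r + z) \<le> R r" using R[of r "R r"] that by auto
      then show ?thesis using nz[OF that, of r] \<open>R r > 0\<close>
        by (simp add: dist_eq[symmetric] field_simps)
    qed
    then have "1 / R r \<le> infdist (- (\<i> * of_real r)) ?S"
      unfolding infdist_def using ne by (auto intro: cINF_greatest)
    then show ?thesis using \<open>R r > 0\<close> by (smt (verit) zero_less_divide_1_iff)
  qed
  have "continuous_on {-s..s} (\<lambda>r. infdist (- (\<i> * of_real r)) ?S)"
    by (intro continuous_intros)
  moreover have "{-s..s} \<noteq> {}" using \<open>s \<ge> 0\<close> by simp
  ultimately have "\<exists>r0\<in>{-s..s}. \<forall>r\<in>{-s..s}.
      infdist (- (\<i> * of_real r0)) ?S \<le> infdist (- (\<i> * of_real r)) ?S"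
    by (intro continuous_attains_inf compact_Icc)
  then obtain r0 where r0: "\<And>r. r \<in> {-s..s} \<Longrightarrow>
      infdist (- (\<i> * of_real r0)) ?S \<le> infdist (- (\<i> * of_real r)) ?S"
    by blast
  define \<delta> where "\<delta> = infdist (- (\<i> * of_real r0)) ?S"
  have "\<delta> > 0" unfolding \<delta>_def by (rule infdist_pos)
  have bdd: "bdd_above (R ` {r. \<bar>r\<bar> \<le> s})"
  proof (rule bdd_aboveI2)
    fix r assume "r \<in> {r. \<bar>r\<bar> \<le> s}"
    show "R r \<le> 1 / \<delta>" unfolding R
    proof
      fix z assume "z \<in> ?S"
      then have "\<delta> \<le> cmod (\<i> * of_real r + z)"
        using r0[of r] \<open>r \<in> _\<close> infdist_le[OF \<open>z \<in> ?S\<close>, of "- (\<i> * of_real r)"]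
        by (auto simp: \<delta>_def dist_eq abs_le_iff)
      then show "1 / cmod (\<i> * of_real r + z) \<le> 1 / \<delta>"
        using \<open>\<delta> > 0\<close> by (simp add: frac_le)
    qed
  qed
  have "0 \<in> {r. \<bar>r\<bar> \<le> s}" using \<open>s \<ge> 0\<close> by simp
  then have "{r. \<bar>r\<bar> \<le> s} \<noteq> {}" by blast
  then have "(SUP r\<in>{r. \<bar>r\<bar> \<le> s}. R r) \<le> W \<longleftrightarrow> (\<forall>r\<in>{r. \<bar>r\<bar> \<le> s}. R r \<le> W)"
    by (intro cSUP_le_iff bdd)
  then show ?thesis using R by (auto simp: resolvent_growth_def R_def)
qed

section \<open>Decay and growth in terms of points of the spectrum\<close>

text \<open>Here \<open>N t\<close> stands for the norm of \<open>T(t)A\<inverse>\<close>. A value \<open>\<tau>\<close> need not be of the form \<open>Minv u\<close>,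
  but monotonicity of \<open>M\<close> gives \<open>\<tau> < Minv u\<close> for all \<open>u > M \<tau>\<close>, and then \<open>u\<close> may tend to \<open>M \<tau>\<close>.\<close>

lemma decay_iff_pointwise:
  fixes S :: "complex set" and M N Minv :: "real \<Rightarrow> real"
  assumes S: "S \<subseteq> {z. Re z > 0}" and c: "c > 0" and M0: "M 0 \<ge> 0"
    and mono: "\<And>s s'. 0 \<le> s \<Longrightarrow> s \<le> s' \<Longrightarrow> M s \<le> M s'"
    and Minv: "\<And>u. u \<ge> M 0 \<Longrightarrow> Minv u \<ge> 0 \<and> M (Minv u) = u"
    and N: "\<And>t W. t \<ge> 0 \<Longrightarrow> N t \<le> W \<longleftrightarrow> (\<forall>z\<in>S. exp (- Re z * t) / cmod z \<le> W)"
  shows "(\<exists>C. \<forall>t \<ge> inverse c * M 0. Minv (c * t) \<noteq> 0 \<longrightarrow> N t \<le> C / Minv (c * t)) \<longleftrightarrow>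
    (\<exists>B. \<forall>\<tau> > 0. \<forall>z\<in>S. M \<tau> * Re z \<ge> c * ln (\<tau> / cmod z) - B)"
proof
  assume "\<exists>C. \<forall>t \<ge> inverse c * M 0. Minv (c * t) \<noteq> 0 \<longrightarrow> N t \<le> C / Minv (c * t)"
  then obtain C where C: "\<And>t. t \<ge> inverse c * M 0 \<Longrightarrow> Minv (c * t) \<noteq> 0 \<Longrightarrow> N t \<le> C / Minv (c * t)"
    by blast
  have "M \<tau> * Re z \<ge> c * ln (\<tau> / cmod z) - c * ln C" if "\<tau> > 0" "z \<in> S" for \<tau> z
  proof -
    have z: "Re z > 0" "cmod z > 0" using S \<open>z \<in> S\<close> by auto
    have "(c * ln (\<tau> / cmod z) - c * ln C) / Re z \<le> u" if "u > M \<tau>" for u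
    proof -
      have "u \<ge> M 0" using mono[of 0 \<tau>] \<open>\<tau> > 0\<close> that by simp
      have "\<tau> < Minv u"
        using mono[of "Minv u" \<tau>] Minv[OF \<open>u \<ge> M 0\<close>] that by (cases "\<tau> < Minv u") auto
      have "N (u / c) \<le> C / Minv u"
        using C[of "u / c"] c \<open>u \<ge> M 0\<close> \<open>\<tau> > 0\<close> \<open>\<tau> < Minv u\<close> by (simp add: field_simps)
      then have "exp (- Re z * (u / c)) / cmod z \<le> C / Minv u"
        using N[of "u / c" "C / Minv u"] c \<open>u \<ge> M 0\<close> M0 \<open>z \<in> S\<close> by simp
      then have *: "exp (- Re z * (u / c)) * Minv u \<le> C * cmod z"
        using z \<open>\<tau> > 0\<close> \<open>\<tau> < Minv u\<close> by (simp add: field_simps)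
      moreover have "exp (- Re z * (u / c)) * \<tau> \<le> exp (- Re z * (u / c)) * Minv u"
        using \<open>\<tau> < Minv u\<close> by simp
      ultimately have le: "exp (- Re z * (u / c)) * \<tau> \<le> C * cmod z" by linarith
      then have "C * cmod z > 0" using \<open>\<tau> > 0\<close> by (smt (verit) exp_gt_zero mult_pos_pos)
      then have "C > 0" using z by (simp add: zero_less_mult_iff)
      from le have "ln (exp (- Re z * (u / c)) * \<tau>) \<le> ln (C * cmod z)"
        using \<open>\<tau> > 0\<close> by (intro ln_mono) auto
      then have "- Re z * (u / c) + ln \<tau> \<le> ln C + ln (cmod z)"
        using \<open>\<tau> > 0\<close> \<open>C > 0\<close> z by (simp add: ln_mult)
      then have "ln (\<tau> / cmod z) - ln C \<le> Re z * u / c"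
        using \<open>\<tau> > 0\<close> z by (simp add: ln_div)
      then have "c * (ln (\<tau> / cmod z) - ln C) \<le> Re z * u"
        using c by (simp add: field_simps)
      then show ?thesis using z by (simp add: field_simps)
    qed
    then have "(c * ln (\<tau> / cmod z) - c * ln C) / Re z \<le> M \<tau>" by (rule dense_ge)
    then show ?thesis using z by (simp add: field_simps)
  qed
  then show "\<exists>B. \<forall>\<tau> > 0. \<forall>z\<in>S. M \<tau> * Re z \<ge> c * ln (\<tau> / cmod z) - B" by blast
next
  assume "\<exists>B. \<forall>\<tau> > 0. \<forall>z\<in>S. M \<tau> * Re z \<ge> c * ln (\<tau> / cmod z) - B"
  then obtain B where B: "\<And>\<tau> z. \<tau> > 0 \<Longrightarrow> z \<in> S \<Longrightarrow> M \<tau> * Re z \<ge> c * ln (\<tau> / cmod z) - B" by blast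
  have "N t \<le> exp (B / c) / Minv (c * t)" if t: "t \<ge> inverse c * M 0" "Minv (c * t) \<noteq> 0" for t
  proof -
    have "c * t \<ge> M 0" "t \<ge> 0"
      using t(1) c M0 by (auto simp: field_simps intro: order_trans[of 0 "M 0 / c"])
    define \<tau> where "\<tau> = Minv (c * t)"
    have "\<tau> > 0" "M \<tau> = c * t" using Minv[OF \<open>c * t \<ge> M 0\<close>] t(2) by (auto simp: \<tau>_def)
    have "exp (- Re z * t) / cmod z \<le> exp (B / c) / \<tau>" if "z \<in> S" for z
    proof -
      have z: "cmod z > 0" using S \<open>z \<in> S\<close> by auto
      have "c * ln (\<tau> / cmod z) \<le> c * (t * Re z + B / c)"
        using B[OF \<open>\<tau> > 0\<close> that] \<open>M \<tau> = c * t\<close> c by (simp add: algebra_simps)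
      then have "ln (\<tau> / cmod z) \<le> t * Re z + B / c" using c by simp
      then have "\<tau> / cmod z \<le> exp (t * Re z + B / c)"
        using \<open>\<tau> > 0\<close> z by (metis divide_pos_pos exp_le_cancel_iff exp_ln)
      then show ?thesis using \<open>\<tau> > 0\<close> z
        by (simp add: exp_add exp_minus field_simps)
    qed
    then show ?thesis using N[OF \<open>t \<ge> 0\<close>] by (simp add: \<tau>_def)
  qed
  then show "\<exists>C. \<forall>t \<ge> inverse c * M 0. Minv (c * t) \<noteq> 0 \<longrightarrow> N t \<le> C / Minv (c * t)" by blast
qed

lemma ratio_iff_pointwise:
  fixes S :: "complex set" and M :: "real \<Rightarrow> real"
  assumes "S \<noteq> {}" and S: "S \<subseteq> {z. Re z > 0}" and c: "c > 0"
    and M: "\<And>s W. s \<ge> 0 \<Longrightarrow>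
      M s \<le> W \<longleftrightarrow> (\<forall>r z. \<bar>r\<bar> \<le> s \<longrightarrow> z \<in> S \<longrightarrow> 1 / cmod (\<i> * of_real r + z) \<le> W)"
  shows "(\<exists>B. \<forall>\<tau> > 0. \<forall>s \<ge> 1. M \<tau> / M s \<ge> c * ln (\<tau> / s) - B) \<longleftrightarrow>
    (\<exists>B. \<forall>\<tau> > 0. \<forall>z\<in>S. M \<tau> * Re z \<ge> c * ln (\<tau> / cmod z) - B)"
proof -
  obtain z0 where "z0 \<in> S" using \<open>S \<noteq> {}\<close> by auto
  have norm_pos: "cmod (\<i> * of_real r + z) > 0" if "z \<in> S" for r z
    using S that by (auto simp: complex_eq_iff)
  have M_ge: "1 / cmod (\<i> * of_real r + z) \<le> M s" if "\<bar>r\<bar> \<le> s" "z \<in> S" for r z s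
    using M[of s "M s"] that by auto
  have M_pos: "M s > 0" if "s \<ge> 0" for s
    using M_ge[of 0 s z0] norm_pos[of z0 0] \<open>z0 \<in> S\<close> that by (smt (verit) zero_less_divide_1_iff)
  \<comment> \<open>Replacing \<open>x\<close> by some \<open>y \<ge> x / K\<close> raises the logarithm by at most \<open>log K\<close>.\<close>
  have ln_shift: "c * ln (\<tau> / y) \<le> c * ln (\<tau> / x) + c * ln K"
    if "\<tau> > 0" "x > 0" "y > 0" "K > 0" "x \<le> K * y" for \<tau> x y K
  proof -
    have "ln x \<le> ln (K * y)" using that by (intro ln_mono) auto
    then have "ln (\<tau> / y) \<le> ln (\<tau> / x) + ln K" using that by (simp add: ln_mult ln_div)
    then show ?thesis using c by (metis distrib_left mult_le_cancel_left_pos)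
  qed
  show ?thesis
  proof
    assume "\<exists>B. \<forall>\<tau> > 0. \<forall>s \<ge> 1. M \<tau> / M s \<ge> c * ln (\<tau> / s) - B"
    then obtain B where B: "\<And>\<tau> s. \<tau> > 0 \<Longrightarrow> s \<ge> 1 \<Longrightarrow> M \<tau> / M s \<ge> c * ln (\<tau> / s) - B" by blast
    \<comment> \<open>As \<open>1 / M 0\<close> is the distance from \<open>0\<close> to \<open>S\<close>, this gives \<open>max 1 \<bar>z\<bar> \<le> K \<bar>z\<bar>\<close> on \<open>S\<close>.\<close>
    define K where "K = max 1 (M 0)"
    have "M \<tau> * Re z \<ge> c * ln (\<tau> / cmod z) - (B + c * ln K)" if "\<tau> > 0" "z \<in> S" for \<tau> z
    proof -
      define s where "s = max 1 \<bar>Im z\<bar>"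
      have z: "Re z > 0" "cmod z > 0" using S \<open>z \<in> S\<close> by auto
      have "s \<ge> 1" by (simp add: s_def)
      have "1 \<le> M 0 * cmod z" using M_ge[of 0 0 z] \<open>z \<in> S\<close> z by (simp add: field_simps)
      moreover have "M 0 * cmod z \<le> K * cmod z" "1 * cmod z \<le> K * cmod z"
        unfolding K_def by (intro mult_right_mono; simp)+
      ultimately have "s \<le> K * cmod z"
        using abs_Im_le_cmod[of z] unfolding s_def by simp
      then have "c * ln (\<tau> / cmod z) \<le> c * ln (\<tau> / s) + c * ln K"
        using \<open>\<tau> > 0\<close> z \<open>s \<ge> 1\<close> by (intro ln_shift) (auto simp: K_def)
      moreover have "M \<tau> / M s \<le> M \<tau> * Re z"
      proof -
        have "\<i> * of_real (- Im z) + z = of_real (Re z)" by (simp add: complex_eq_iff)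
        then have "1 / Re z \<le> M s"
          using M_ge[of "- Im z" s z] \<open>z \<in> S\<close> z by (simp add: s_def)
        then have "1 / M s \<le> Re z" using z M_pos[of s] \<open>s \<ge> 1\<close> by (simp add: field_simps)
        then show ?thesis
          using mult_left_mono[of "1 / M s" "Re z" "M \<tau>"] M_pos[of \<tau>] \<open>\<tau> > 0\<close> by simp
      qed
      ultimately show ?thesis using B[OF \<open>\<tau> > 0\<close> \<open>s \<ge> 1\<close>] by linarith
    qed
    then show "\<exists>B. \<forall>\<tau> > 0. \<forall>z\<in>S. M \<tau> * Re z \<ge> c * ln (\<tau> / cmod z) - B" by blast
  next
    assume "\<exists>B. \<forall>\<tau> > 0. \<forall>z\<in>S. M \<tau> * Re z \<ge> c * ln (\<tau> / cmod z) - B"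
    then obtain B where B: "\<And>\<tau> z. \<tau> > 0 \<Longrightarrow> z \<in> S \<Longrightarrow> M \<tau> * Re z \<ge> c * ln (\<tau> / cmod z) - B" by blast
    define K where "K = 1 + cmod z0"
    have "M \<tau> / M s \<ge> c * ln (\<tau> / s) - (B + c * ln K)" if "\<tau> > 0" "s \<ge> 1" for \<tau> s
    proof -
      define X where "X = c * ln (\<tau> / s) - (B + c * ln K)"
      have "M \<tau> > 0" "M s > 0" using M_pos that by auto
      have near: "X \<le> M \<tau> * Re y" if "y \<in> S" "cmod y \<le> K * s" for y
      proof -
        have "cmod y > 0" using S that by auto
        moreover have "K > 0" by (simp add: K_def add_pos_nonneg)
        ultimately have "c * ln (\<tau> / s) \<le> c * ln (\<tau> / cmod y) + c * ln K"
          using \<open>\<tau> > 0\<close> \<open>s \<ge> 1\<close> that by (intro ln_shift) auto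
        then show ?thesis using B[OF \<open>\<tau> > 0\<close> \<open>y \<in> S\<close>] by (simp add: X_def)
      qed
      have X_le: "X \<le> M \<tau> * d" if "\<bar>r\<bar> \<le> s" "z \<in> S" and d: "d = cmod (\<i> * of_real r + z)" for r z d
      proof -
        \<comment> \<open>If \<open>z\<close> is farther from \<open>-ir\<close> than the fixed point \<open>z0\<close> is from \<open>0\<close>, then \<open>z0\<close>
          serves in place of \<open>z\<close>; otherwise \<open>\<bar>z\<bar> \<le> d + s\<close> is small enough.\<close>
        obtain y where "y \<in> S" "Re y \<le> d" "cmod y \<le> K * s"
        proof (cases "cmod z0 \<le> d")
          case True
          have "cmod z0 * 1 \<le> K * s"
            using \<open>s \<ge> 1\<close> by (intro mult_mono) (auto simp: K_def)
          then show ?thesis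
            using that[of z0] True \<open>z0 \<in> S\<close> complex_Re_le_cmod[of z0] by simp
        next
          case False
          have "cmod z \<le> d + s"
            using norm_triangle_ineq4[of "\<i> * of_real r + z" "\<i> * of_real r"] \<open>\<bar>r\<bar> \<le> s\<close>
            by (simp add: d norm_mult)
          also have "\<dots> \<le> cmod z0 * s + s"
            using False \<open>s \<ge> 1\<close> mult_left_mono[of 1 s "cmod z0"] by simp
          finally have "cmod z \<le> K * s" by (simp add: K_def algebra_simps)
          moreover have "Re z \<le> d"
            using complex_Re_le_cmod[of "\<i> * of_real r + z"] by (simp add: d)
          ultimately show ?thesis using that \<open>z \<in> S\<close> by blast
        qed
        then have "X \<le> M \<tau> * Re y" using near by blast
        also have "\<dots> \<le> M \<tau> * d" using \<open>Re y \<le> d\<close> \<open>M \<tau> > 0\<close> by simp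
        finally show ?thesis .
      qed
      have "X \<le> M \<tau> / M s"
      proof (cases "X \<le> 0")
        case True
        then show ?thesis using \<open>M \<tau> > 0\<close> \<open>M s > 0\<close> by (smt (verit) divide_pos_pos)
      next
        case False
        have "1 / cmod (\<i> * of_real r + z) \<le> M \<tau> / X" if "\<bar>r\<bar> \<le> s" "z \<in> S" for r z
          using X_le[OF that refl] False norm_pos[OF \<open>z \<in> S\<close>, of r] by (simp add: field_simps)
        then have "M s \<le> M \<tau> / X" using M[of s "M \<tau> / X"] \<open>s \<ge> 1\<close> by auto
        then show ?thesis using False \<open>M s > 0\<close> by (simp add: field_simps)
      qed
      then show ?thesis by (simp add: X_def)
    qed
    then show "\<exists>B. \<forall>\<tau> > 0. \<forall>s \<ge> 1. M \<tau> / M s \<ge> c * ln (\<tau> / s) - B" by blast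
  qed
qed

section \<open>The equivalence\<close>

theorem proposition5p1:
  fixes T :: "real \<Rightarrow> 'a::complex_banach \<Rightarrow> 'a"
    and D :: "'a set"
    and A :: "'a \<Rightarrow> 'a"
    and M Minv :: "real \<Rightarrow> real"
    and c :: real
  assumes qm: "quasi_multiplication_semigroup T D A"
    and spec_pos: "spectrum D A \<subseteq> {z. Re z > 0}"
    and spec_inf: "(INF z\<in>spectrum D A. ereal (Re z)) = 0"
    and M: "\<And>s. s \<ge> 0 \<Longrightarrow> M s = resolvent_growth D A s"
    and Minv: "\<And>u. u \<ge> M 0 \<Longrightarrow> Minv u \<ge> 0 \<and> M (Minv u) = u"
    and c: "c > 0"
  shows "(\<exists>C. \<forall>t \<ge> inverse c * M 0. Minv (c * t) \<noteq> 0 \<longrightarrow>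
            onorm (T t \<circ> inv_into D A) \<le> C / Minv (c * t))
     \<longleftrightarrow> (\<exists>B. \<forall>\<tau> > 0. \<forall>s \<ge> 1. M \<tau> / M s \<ge> c * ln (\<tau> / s) - B)"
proof -
  let ?S = "spectrum D A"
  have ne: "?S \<noteq> {}" using spec_inf by (auto simp: top_ereal_def)
  have M_le: "M s \<le> W \<longleftrightarrow> (\<forall>r z. \<bar>r\<bar> \<le> s \<longrightarrow> z \<in> ?S \<longrightarrow> 1 / cmod (\<i> * of_real r + z) \<le> W)"
    if "s \<ge> 0" for s W
    using resolvent_growth_le_iff[OF qm ne spec_pos that] M[OF that] by simp
  have mono: "M s \<le> M s'" if "0 \<le> s" "s \<le> s'" for s s'
    using M_le[of s' "M s'"] M_le[of s "M s'"] that by auto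
  have "M 0 \<ge> 0"
  proof -
    obtain z where "z \<in> ?S" using ne by auto
    then have "1 / cmod (\<i> * of_real 0 + z) \<le> M 0" using M_le[of 0 "M 0"] by auto
    then show ?thesis by (smt (verit) norm_ge_zero zero_le_divide_1_iff)
  qed
  have zero: "0 *\<^sub>C x = 0" for x :: 'a using scaleC_of_real[of 0 x] by simp
  have "0 \<notin> ?S" using spec_pos by auto
  then have N: "onorm (T t \<circ> inv_into D A) \<le> W \<longleftrightarrow> (\<forall>z\<in>?S. exp (- Re z * t) / cmod z \<le> W)"
    if "t \<ge> 0" for t W
    using semigroup_resolvent_norm_le_iff[OF qm ne, of 0 t W] that by (simp add: zero)
  show ?thesis
    using decay_iff_pointwise[OF spec_pos c \<open>M 0 \<ge> 0\<close> mono Minv N]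
      ratio_iff_pointwise[OF ne spec_pos c M_le] by simp
qed

end
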